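(* Let $V$ be a Möbius vertex algebra, $G$ an abelian group of automorphisms of $V$, $n\ge2$ an integer and $z\in\mathbb C^\times$. For objects $W_1,W_2$ of $\mathcal C_n^G$ let $(W_1\boxtimes_{P(z)}W_2,\boxtimes_{P(z)})$ be the $P(z)$-tensor product of $W_1$ and $W_2$ in $\mathcal C_n^G$, and for morphisms $f_1:W_1\to \widetilde W_1$, $f_2:W_2\to \widetilde W_2$ in $\mathcal C_n^G$ let $f_1\boxtimes_{P(z)}f_2:W_1\boxtimes_{P(z)}W_2\to \widetilde W_1\boxtimes_{P(z)}\widetilde W_2$ be the morphism determined by the universal property, i.e. the unique module map with $\overline{f_1\boxtimes_{P(z)}f_2}\,(w_1\boxtimes_{P(z)}w_2)=f_1(w_1)\boxtimes_{P(z)}f_2(w_2)$ for all $w_1\in W_1$, $w_2\in W_2$. Then the assignment $(W_1,W_2)\mapsto W_1\boxtimes_{P(z)}W_2$, $(f_1,f_2)\mapsto f_1\boxtimes_{P(z)}f_2$ is a functor from $\mathcal C_n^G\times\mathcal C_n^G$ to $\mathcal C_n^G$.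
   Context: All vector spaces are over $\mathbb C$. **Vertex algebra and automorphisms.** A grading-restricted vertex algebra is a $\mathbb Z$-graded space $V=\coprod_{n\in\mathbb Z}V_{(n)}$ with $\dim V_{(n)}<\infty$, $V_{(n)}=0$ for $n$ sufficiently negative, a vertex operator map $Y_V:V\otimes V\to V((x))$, a vacuum $\mathbf 1\in V_{(0)}$, and operators $L_V(0)$ (acting as $n$ on $V_{(n)}$) and $L_V(-1)$, satisfying the usual vacuum and creation properties, the Jacobi identity, $[L_V(0),Y_V(v,x)]=x\frac{d}{dx}Y_V(v,x)+Y_V(L_V(0)v,x)$ and $\frac{d}{dx}Y_V(v,x)=Y_V(L_V(-1)v,x)=[L_V(-1),Y_V(v,x)]$. A Möbius vertex algebra (quasi-vertex operator algebra) has in addition an operator $L_V(1)$ on $V$ such that $[L_V(0),L_V(\pm1)]=\mp L_V(\pm1)$, $[L_V(1),L_V(-1)]=2L_V(0)$, and $[L_V(1),Y_V(v,x)]=Y_V((L_V(1)+2xL_V(0)+x^2L_V(-1))v,x)$. Put $V_+=\coprod_{n\ge1}V_{(n)}$. Automorphisms of $V$ are linear automorphisms preserving $Y_V$, $\mathbf 1$ and commuting with $L_V(0),L_V(\pm1)$; they may have infinite order and need not be semisimple. For an automorphism $g$, $P_V^g=\{\alpha\in\mathbb C: \Re(\alpha)\in[0,1),\ e^{2\pi \mathrm i\alpha}\text{ is an eigenvalue of }g\}$, $V^{[\alpha]}$ is the generalized eigenspace of $g$ with eigenvalue $e^{2\pi\mathrm i\alpha}$, so $V=\coprod_{\alpha\in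 P_V^g}V^{[\alpha]}$; $V_+^{[\alpha]}=V^{[\alpha]}\cap V_+$. Write $g=e^{2\pi\mathrm i\mathcal L_g}$, $\mathcal L_g=\mathcal S_g+\mathcal N_g$, where $\mathcal S_g$ acts as $\alpha$ on $V^{[\alpha]}$ and $\mathcal N_g$ is the locally nilpotent operator commuting with $\mathcal S_g$. For formal expressions, $y^{\mathcal L_g}v=y^{\alpha}e^{(\log y)\mathcal N_g}v$ for $v\in V^{[\alpha]}$, where powers and logarithms of $x_1-x_2$, $x_2-x_1$, $x_2+x_0$ are expanded in nonnegative powers of the second variable, and $\log$ of a quotient is the difference of logs. $\delta(x)=\sum_{n\in\mathbb Z}x^n$. **Twisted modules.** A weak $g$-twisted $V$-module is a vector space $W$ with operators $L_W(0),L_W(-1)$ and a linear map $Y_W:V\otimes W\to W\{x\}[\log x]$ ($W\{x\}$: formal series with arbitrary complex powers), $Y_W(v,x)w=\sum_{n\in\mathbb C}\sum_{k\in\mathbb N}v_{n,k}w\,x^{-n-1}(\log x)^k$, such that: (1) for $v\in V,w\in W$, $v_{n,k}w=0$ for $\Re(n)$ sufficiently large; (2) equivariance: $Y_W^{p+1}(gv,z)w=Y_W^p(v,z)w$ for $p\in\mathbb Z$, $z\in\mathbb C^\times$, where $Y_W^p(v,z)$ is obtained by substituting $x^n\mapsto e^{nl_p(z)}$, $\log x\mapsto l_p(z)=\log|z|+\mathrm i\arg z+2\pi\mathrm ip$, $0\le\arg z<2\pi$; (3) $Y_W(\mathbf 1,x)w=w$; (4) Jacobi identity $$x_0^{-1}\delta\Bigl(\tfrac{x_1-x_2}{x_0}\Bigr)Y_W(u,x_1)Y_W(v,x_2)-x_0^{-1}\delta\Bigl(\tfrac{-x_2+x_1}{x_0}\Bigr)Y_W(v,x_2)Y_W(u,x_1)=x_1^{-1}\delta\Bigl(\tfrac{x_2+x_0}{x_1}\Bigr)Y_W\Bigl(Y_V\bigl(\bigl(\tfrac{x_2+x_0}{x_1}\bigr)^{\mathcal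 L_g}u,x_0\bigr)v,x_2\Bigr);$$ (5) $[L_W(0),Y_W(v,x)]=x\frac{d}{dx}Y_W(v,x)+Y_W(L_V(0)v,x)$; (6) $\frac{d}{dx}Y_W(v,x)=Y_W(L_V(-1)v,x)=[L_W(-1),Y_W(v,x)]$. Write $v_n=v_{n,0}$. No action of $g$ on $W$ is required. A generalized $g$-twisted module is a weak one with a grading $W=\coprod_{m\in\mathbb C}W_{[m]}$ such that each $w\in W_{[m]}$ satisfies $(L_W(0)-m)^Kw=0$ for some $K\in\mathbb Z_+$; it is lower-bounded if for some $N\in\mathbb Z$, $W_{[m]}=0$ whenever $\Re(m)<N$, and grading-restricted if it is lower-bounded and all $\dim W_{[m]}<\infty$. $\overline W=\prod_{m}W_{[m]}$. Module maps between $g$-twisted modules (same $g$) are linear maps commuting with $Y$, $L(0)$ and $L(-1)$; they preserve the gradings, and $\bar f$ denotes the natural extension of a module map $f$ to the completions. The contragredient of a lower-bounded generalized $g$-twisted module $W$ is the generalized $g^{-1}$-twisted module $W'$ whose graded space is $W'=\coprod_m W_{[m]}^*$, $(W')_{[m]}=W_{[m]}^*$, with twisted vertex operators $\langle Y_{W'}(v,x)w',w\rangle=\langle w',Y_W(e^{xL_V(1)}(-x^{-2})^{L_V(0)}v,x^{-1})w\rangle$ (with $\log x^{-1}=-\log x$) and $L_{W'}(0)$ the adjoint of $L_W(0)$; the existence of this contragredient twisted module, including its operator $L_{W'}(-1)$, is taken as known. For an integer $n\ge2$, $C_n(W)$ is the span of all $u_{\alpha-n}w$ with $\alpha\in P_V^g$,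 $u\in V_+^{[\alpha]}$, $w\in W$; $W$ is $C_n$-cofinite if $\dim W/C_n(W)<\infty$. $\mathcal C_n^G$ is the category whose objects are the $C_n$-cofinite grading-restricted generalized $g$-twisted $V$-modules, $g\in G$, and whose morphisms are module maps between $g$-twisted modules for the same $g$. **Twisted intertwining operators.** For commuting $g_1,g_2$ and generalized $g_1$-, $g_2$-, $g_1g_2$-twisted modules $W_1,W_2,W_3$, a twisted intertwining operator of type $\binom{W_3}{W_1W_2}$ is a linear map $\mathcal Y:W_1\otimes W_2\to W_3\{x\}[\log x]$, $\mathcal Y(w_1,x)w_2=\sum_{k=0}^K\sum_{n\in\mathbb C}\mathcal Y_{n,k}(w_1)w_2\,x^{-n-1}(\log x)^k$, such that: $\mathcal Y_{n,k}(w_1)w_2=0$ for $\Re(n)$ sufficiently large; for $v\in V$, $w_1\in W_1$, $$x_0^{-1}\delta\Bigl(\tfrac{x_1-x_2}{x_0}\Bigr)Y_{W_3}\Bigl(\bigl(\tfrac{x_1-x_2}{x_0}\bigr)^{\mathcal L_{g_1}}v,x_1\Bigr)\mathcal Y(w_1,x_2)-x_0^{-1}\delta\Bigl(\tfrac{x_2-x_1}{-x_0}\Bigr)\mathcal Y(w_1,x_2)Y_{W_2}\Bigl(e^{\pi\mathrm i\mathcal L_{g_1}}\bigl(\tfrac{x_2-x_1}{x_0}\bigr)^{\mathcal L_{g_1}}v,x_1\Bigr)$$ $$=x_1^{-1}\delta\Bigl(\tfrac{x_2+x_0}{x_1}\Bigr)\mathcal Y\Bigl(Y_{W_1}\bigl(\bigl(\tfrac{x_2+x_0}{x_1}\bigr)^{\mathcal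 L_{g_2}}v,x_0\bigr)w_1,x_2\Bigr)$$ on $W_2$; $L_{W_3}(0)\mathcal Y(w_1,x)-\mathcal Y(w_1,x)L_{W_2}(0)=x\frac{d}{dx}\mathcal Y(w_1,x)+\mathcal Y(L_{W_1}(0)w_1,x)$; and $\frac{d}{dx}\mathcal Y(w_1,x)=\mathcal Y(L_{W_1}(-1)w_1,x)=L_{W_3}(-1)\mathcal Y(w_1,x)-\mathcal Y(w_1,x)L_{W_2}(-1)$. For $z\in\mathbb C^\times$, $\mathcal Y(w_1,z)w_2\in\overline{W_3}$ is obtained by substituting $x^{m}\mapsto e^{m\log z}$, $\log x\mapsto\log z=\log|z|+\mathrm i\arg z$, $0\le\arg z<2\pi$. **$P(z)$-products and tensor products.** A twisted $P(z)$-intertwining map of type $\binom{W_3}{W_1W_2}$ is a linear map $I:W_1\otimes W_2\to\overline{W_3}$ of the form $I(w_1\otimes w_2)=\mathcal Y(w_1,z)w_2$ for a twisted intertwining operator $\mathcal Y$ of that type. For $W_1$ ($g_1$-twisted) and $W_2$ ($g_2$-twisted) in $\mathcal C_n^G$, a $P(z)$-product in $\mathcal C_n^G$ is a pair $(W_3,I)$ with $W_3$ a $C_n$-cofinite grading-restricted generalized $g_1g_2$-twisted module and $I$ a twisted $P(z)$-intertwining map of type $\binom{W_3}{W_1W_2}$. A $P(z)$-tensor product is a $P(z)$-product $(W_0,I_0)$ such that for every $P(z)$-product $(W_3,I)$ there is a unique module map $f:W_0\to W_3$ with $\bar f\circ I_0=I$. The $P(z)$-tensor product used is the following. For a $P(z)$-product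 $(W_3,I)$ and $w_3'\in W_3'$, let $\lambda_{I,w_3'}\in(W_1\otimes W_2)^*$, $\lambda_{I,w_3'}(w_1\otimes w_2)=\langle w_3',I(w_1\otimes w_2)\rangle$. The span $D_{P(z)}(W_1,W_2)$ of all such functionals is a grading-restricted generalized $(g_1g_2)^{-1}$-twisted module with weight-$m$ space the span of the $\lambda_{I,w_3'}$, $w_3'\in(W_3')_{[m]}$, with $Y(v,x)\lambda_{I,w_3'}=\lambda_{I,Y_{W_3'}(v,x)w_3'}$ and $L(j)\lambda_{I,w_3'}=\lambda_{I,L_{W_3'}(j)w_3'}$ for $j=0,-1$. Then $W_1\boxtimes_{P(z)}W_2=(D_{P(z)}(W_1,W_2))'$, and $\boxtimes_{P(z)}(w_1\otimes w_2)=w_1\boxtimes_{P(z)}w_2\in\overline{W_1\boxtimes_{P(z)}W_2}$ is given by $\langle\lambda,w_1\boxtimes_{P(z)}w_2\rangle=\lambda(w_1\otimes w_2)$ for $\lambda\in D_{P(z)}(W_1,W_2)$; $W_1\boxtimes_{P(z)}W_2$ is an object of $\mathcal C_n^G$ and the pair is a $P(z)$-tensor product of $W_1$ and $W_2$ in $\mathcal C_n^G$. *)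

theory Defs
  imports "HOL-Analysis.Analysis" "HOL-Library.FuncSet"
begin

section \<open>Complex vector spaces and gradings\<close>

class cvector = ab_group_add +
  fixes cscale :: "complex \<Rightarrow> 'a \<Rightarrow> 'a"  (infixr "*\<^sub>C" 75)
  assumes cscale_add_right: "a *\<^sub>C (x + y) = a *\<^sub>C x + a *\<^sub>C y"
    and cscale_add_left: "(a + b) *\<^sub>C x = a *\<^sub>C x + b *\<^sub>C x"
    and cscale_cscale: "a *\<^sub>C (b *\<^sub>C x) = (a * b) *\<^sub>C x"
    and cscale_one: "1 *\<^sub>C x = x"

instantiation complex :: cvector
begin
definition "cscale_complex a (x :: complex) = a * x"
instance by standard (simp_all add: cscale_complex_def algebra_simps)
end

global_interpretation cvec: vector_space "cscale :: complex \<Rightarrow> 'a::cvector \<Rightarrow> 'a"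
  by standard (rule cscale_add_right cscale_add_left cscale_cscale cscale_one)+

abbreviation clinear :: "('a::cvector \<Rightarrow> 'b::cvector) \<Rightarrow> bool" where
  "clinear \<equiv> Vector_Spaces.linear cscale cscale"

definition clinear_on :: "'a::cvector set \<Rightarrow> 'b::cvector set \<Rightarrow> ('a \<Rightarrow> 'b) \<Rightarrow> bool" where
  "clinear_on S T f \<longleftrightarrow> (\<forall>x\<in>S. f x \<in> T) \<and>
     (\<forall>x\<in>S. \<forall>y\<in>S. f (x + y) = f x + f y) \<and> (\<forall>c. \<forall>x\<in>S. f (c *\<^sub>C x) = c *\<^sub>C f x)"

definition finite_dim :: "'a::cvector set \<Rightarrow> bool" where
  "finite_dim S \<longleftrightarrow> (\<exists>B. finite B \<and> cvec.span B = S)"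

text \<open>\<open>direct_sum S gr\<close>: the subspace \<open>S\<close> is the internal direct sum of the subspaces \<open>gr i\<close>.\<close>

definition is_decomposition :: "('i \<Rightarrow> 'a::cvector set) \<Rightarrow> 'a \<Rightarrow> ('i \<Rightarrow> 'a) \<Rightarrow> bool" where
  "is_decomposition gr w d \<longleftrightarrow>
     (\<forall>i. d i \<in> gr i) \<and> finite {i. d i \<noteq> 0} \<and> w = (\<Sum>i | d i \<noteq> 0. d i)"

definition direct_sum :: "'a::cvector set \<Rightarrow> ('i \<Rightarrow> 'a set) \<Rightarrow> bool" where
  "direct_sum S gr \<longleftrightarrow> cvec.subspace S \<and> (\<forall>i. cvec.subspace (gr i) \<and> gr i \<subseteq> S) \<and>
     (\<forall>w\<in>S. \<exists>!d. is_decomposition gr w d)"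

definition component :: "('i \<Rightarrow> 'a::cvector set) \<Rightarrow> 'i \<Rightarrow> 'a \<Rightarrow> 'a" where
  "component gr i w = (THE d. is_decomposition gr w d) i"

section \<open>Formal series in three variables and their logarithms\<close>

text \<open>
  An exponent \<open>e\<close> stands for the monomial whose factor in the variable \<open>i\<close> is
  \<open>i\<close> to the power \<open>fst (e i)\<close> times \<open>log i\<close> to the power \<open>snd (e i)\<close>;
  a formal series is its coefficient function.
\<close>

datatype var = X0 | X1 | X2

type_synonym expo = "var \<Rightarrow> complex \<times> nat"
type_synonym 'a series = "expo \<Rightarrow> 'a"

definition mon :: "var \<Rightarrow> complex \<Rightarrow> nat \<Rightarrow> expo" where
  "mon i a k = (\<lambda>j. if j = i then (a, k) else (0, 0))"

definition mon_mult :: "expo \<Rightarrow> expo \<Rightarrow> expo"  (infixl "\<odot>" 70) where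
  "d \<odot> e = (\<lambda>i. (fst (d i) + fst (e i), snd (d i) + snd (e i)))"

text \<open>
  \<open>series_apply A S\<close> applies a linear map \<open>A\<close> with series values to the coefficients of the
  series \<open>S\<close> and multiplies the monomials. In all products formed below, every coefficient
  is a finite sum.
\<close>

definition series_apply :: "('a::zero \<Rightarrow> 'b::comm_monoid_add series) \<Rightarrow> 'a series \<Rightarrow> 'b series" where
  "series_apply A S e =
     (\<Sum>(d, d') \<in> {(d, d'). d \<odot> d' = e \<and> S d \<noteq> 0 \<and> A (S d) d' \<noteq> 0}. A (S d) d')"

definition series_mult :: "complex series \<Rightarrow> 'a::cvector series \<Rightarrow> 'a series" where
  "series_mult f F = series_apply (\<lambda>c e. c *\<^sub>C F e) f"

definition series_one :: "complex series" where
  "series_one e = (if e = (\<lambda>i. (0, 0)) then 1 else 0)"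

definition series_pow :: "complex series \<Rightarrow> nat \<Rightarrow> complex series" where
  "series_pow f p = (series_mult f ^^ p) series_one"

text \<open>The series of \<open>(i + c j)\<^sup>a\<close> and \<open>log (i + c j)\<close>, expanded in nonnegative powers of \<open>j\<close>.\<close>

definition binom_series :: "var \<Rightarrow> complex \<Rightarrow> var \<Rightarrow> complex \<Rightarrow> complex series" where
  "binom_series i c j a e =
     (\<Sum>m | mon i (a - of_nat m) 0 \<odot> mon j (of_nat m) 0 = e. (a gchoose m) * c ^ m)"

definition log_series :: "var \<Rightarrow> complex \<Rightarrow> var \<Rightarrow> complex series" where
  "log_series i c j e = (if e = mon i 0 1 then 1 else 0) +
     (\<Sum>m | 1 \<le> m \<and> mon i (- of_nat m) 0 \<odot> mon j (of_nat m) 0 = e.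
        (- 1) ^ (m - 1) * c ^ m / of_nat m)"

definition log_quot_series :: "var \<Rightarrow> complex \<Rightarrow> var \<Rightarrow> var \<Rightarrow> complex series" where
  "log_quot_series i c j k e = log_series i c j e - (if e = mon k 0 1 then 1 else 0)"

definition pow_quot_series :: "var \<Rightarrow> complex \<Rightarrow> var \<Rightarrow> var \<Rightarrow> complex \<Rightarrow> complex series" where
  "pow_quot_series i c j k a =
     series_mult (binom_series i c j a) (\<lambda>e. if e = mon k (- a) 0 then 1 else 0)"

text \<open>
  \<open>delta_series k s i c j\<close> is \<open>k\<^sup>-\<^sup>1 \<delta>(s (i + c j) / k)\<close> for \<open>s = 1\<close> or \<open>s = - 1\<close>, the binomials
  being expanded in nonnegative powers of \<open>j\<close>.
\<close>

definition delta_series :: "var \<Rightarrow> complex \<Rightarrow> var \<Rightarrow> complex \<Rightarrow> var \<Rightarrow> complex series" where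
  "delta_series k s i c j e =
     (\<Sum>(n :: int, m :: nat) \<in>
        {(n, m). mon k (- of_int n - 1) 0 \<odot> (mon i (of_int n - of_nat m) 0 \<odot> mon j (of_nat m) 0) = e}.
        (s powi n) * (of_int n gchoose m) * c ^ m)"

text \<open>
  The coefficients of a composition of two operators are written as \<open>F n k n' k'\<close>, belonging to the
  monomial \<open>i\<^sup>-\<^sup>n\<^sup>-\<^sup>1 (log i)\<^sup>k j\<^sup>-\<^sup>n\<^sup>'\<^sup>-\<^sup>1 (log j)\<^sup>k\<^sup>'\<close>.
\<close>

definition two_var :: "var \<Rightarrow> var \<Rightarrow> (complex \<Rightarrow> nat \<Rightarrow> complex \<Rightarrow> nat \<Rightarrow> 'a::zero) \<Rightarrow> 'a series" where
  "two_var i j F e =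
     (if \<forall>l. l \<noteq> i \<and> l \<noteq> j \<longrightarrow> e l = (0, 0)
      then F (- fst (e i) - 1) (snd (e i)) (- fst (e j) - 1) (snd (e j)) else 0)"

text \<open>
  Coefficients of \<open>d/dx\<close> and \<open>x d/dx\<close> of the series \<open>\<Sum> s n k x\<^sup>-\<^sup>n\<^sup>-\<^sup>1 (log x)\<^sup>k\<close>.
\<close>

definition ddx :: "(complex \<Rightarrow> nat \<Rightarrow> 'a::cvector) \<Rightarrow> complex \<Rightarrow> nat \<Rightarrow> 'a" where
  "ddx s n k = (- n) *\<^sub>C s (n - 1) k + of_nat (k + 1) *\<^sub>C s (n - 1) (k + 1)"

definition x_ddx :: "(complex \<Rightarrow> nat \<Rightarrow> 'a::cvector) \<Rightarrow> complex \<Rightarrow> nat \<Rightarrow> 'a" where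
  "x_ddx s n k = (- n - 1) *\<^sub>C s n k + of_nat (k + 1) *\<^sub>C s n (k + 1)"

section \<open>Moebius vertex algebras and their automorphisms\<close>

text \<open>\<open>vmode V u n v\<close> is \<open>u\<^sub>n v\<close>, where \<open>Y\<^sub>V(u, x) v = \<Sum> u\<^sub>n v x\<^sup>-\<^sup>n\<^sup>-\<^sup>1\<close>.\<close>

record 'v vertex_data =
  vgrade :: "int \<Rightarrow> 'v set"
  vmode :: "'v \<Rightarrow> int \<Rightarrow> 'v \<Rightarrow> 'v"
  vacuum :: 'v
  VL0 :: "'v \<Rightarrow> 'v"
  VLm1 :: "'v \<Rightarrow> 'v"
  VL1 :: "'v \<Rightarrow> 'v"

text \<open>The same coefficients indexed like those of a series with complex powers and logarithms.\<close>

definition vcoeff :: "'v::cvector vertex_data \<Rightarrow> 'v \<Rightarrow> complex \<Rightarrow> nat \<Rightarrow> 'v \<Rightarrow> 'v" where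
  "vcoeff V u n k v = (if n \<in> \<int> \<and> k = 0 then vmode V u \<lfloor>Re n\<rfloor> v else 0)"

definition grading_restricted_vertex_algebra :: "'v::cvector vertex_data \<Rightarrow> bool" where
  "grading_restricted_vertex_algebra V \<longleftrightarrow>
     direct_sum UNIV (vgrade V) \<and> (\<forall>n. finite_dim (vgrade V n)) \<and>
     (\<exists>N. \<forall>n<N. vgrade V n = {0}) \<and>
     (\<forall>n u. clinear (vmode V u n)) \<and> (\<forall>n v. clinear (\<lambda>u. vmode V u n v)) \<and>
     (\<forall>u v. \<exists>N. \<forall>n\<ge>N. vmode V u n v = 0) \<and>
     clinear (VL0 V) \<and> clinear (VLm1 V) \<and>
     (\<forall>n. \<forall>v\<in>vgrade V n. VL0 V v = of_int n *\<^sub>C v) \<and>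
     vacuum V \<in> vgrade V 0 \<and>
     (\<forall>n v. vmode V (vacuum V) n v = (if n = - 1 then v else 0)) \<and>
     (\<forall>n\<ge>0. \<forall>u. vmode V u n (vacuum V) = 0) \<and> (\<forall>u. vmode V u (- 1) (vacuum V) = u) \<and>
     (\<forall>u v w e.
        series_mult (delta_series X0 1 X1 (- 1) X2)
          (two_var X1 X2 (\<lambda>n k n' k'. vcoeff V u n k (vcoeff V v n' k' w))) e
      - series_mult (delta_series X0 (- 1) X2 (- 1) X1)
          (two_var X2 X1 (\<lambda>n k n' k'. vcoeff V v n k (vcoeff V u n' k' w))) e
      = series_mult (delta_series X1 1 X2 1 X0)
          (two_var X0 X2 (\<lambda>n k n' k'. vcoeff V (vcoeff V u n k v) n' k' w)) e) \<and>
     (\<forall>v n w. VL0 V (vmode V v n w) - vmode V v n (VL0 V w) =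
        of_int (- n - 1) *\<^sub>C vmode V v n w + vmode V (VL0 V v) n w) \<and>
     (\<forall>v n w. vmode V (VLm1 V v) n w = of_int (- n) *\<^sub>C vmode V v (n - 1) w) \<and>
     (\<forall>v n w. vmode V (VLm1 V v) n w = VLm1 V (vmode V v n w) - vmode V v n (VLm1 V w))"

definition moebius_vertex_algebra :: "'v::cvector vertex_data \<Rightarrow> bool" where
  "moebius_vertex_algebra V \<longleftrightarrow> grading_restricted_vertex_algebra V \<and> clinear (VL1 V) \<and>
     (\<forall>v. VL0 V (VL1 V v) - VL1 V (VL0 V v) = - VL1 V v) \<and>
     (\<forall>v. VL0 V (VLm1 V v) - VLm1 V (VL0 V v) = VLm1 V v) \<and>
     (\<forall>v. VL1 V (VLm1 V v) - VLm1 V (VL1 V v) = 2 *\<^sub>C VL0 V v) \<and>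
     (\<forall>v n w. VL1 V (vmode V v n w) - vmode V v n (VL1 V w) =
        vmode V (VL1 V v) n w + 2 *\<^sub>C vmode V (VL0 V v) (n + 1) w + vmode V (VLm1 V v) (n + 2) w)"

definition V_plus :: "'v::cvector vertex_data \<Rightarrow> 'v set" where
  "V_plus V = cvec.span (\<Union>n\<in>{1..}. vgrade V n)"

definition automorphisms :: "'v::cvector vertex_data \<Rightarrow> ('v \<Rightarrow> 'v) set" where
  "automorphisms V = {g. clinear g \<and> bij g \<and>
     (\<forall>u n v. g (vmode V u n v) = vmode V (g u) n (g v)) \<and> g (vacuum V) = vacuum V \<and>
     (\<forall>v. g (VL0 V v) = VL0 V (g v)) \<and> (\<forall>v. g (VLm1 V v) = VLm1 V (g v)) \<and>
     (\<forall>v. g (VL1 V v) = VL1 V (g v))}"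

definition abelian_automorphism_group :: "'v::cvector vertex_data \<Rightarrow> ('v \<Rightarrow> 'v) set \<Rightarrow> bool" where
  "abelian_automorphism_group V G \<longleftrightarrow> G \<subseteq> automorphisms V \<and> id \<in> G \<and>
     (\<forall>g\<in>G. inv g \<in> G) \<and> (\<forall>g\<in>G. \<forall>h\<in>G. g \<circ> h \<in> G \<and> g \<circ> h = h \<circ> g)"

definition gen_eigenspace :: "('v::cvector \<Rightarrow> 'v) \<Rightarrow> complex \<Rightarrow> 'v set" where
  "gen_eigenspace g c = {v. \<exists>K. ((\<lambda>u. g u - c *\<^sub>C u) ^^ K) v = 0}"

text \<open>\<open>P_set g\<close> is \<open>P\<^sub>V\<^sup>g\<close> and \<open>V_br g \<alpha>\<close> is \<open>V\<^sup>[\<^sup>\<alpha>\<^sup>]\<close>, set to \<open>{0}\<close> for \<open>\<alpha>\<close> outside \<open>P\<^sub>V\<^sup>g\<close>.\<close>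

definition P_set :: "('v::cvector \<Rightarrow> 'v) \<Rightarrow> complex set" where
  "P_set g = {\<alpha>. 0 \<le> Re \<alpha> \<and> Re \<alpha> < 1 \<and> (\<exists>v. v \<noteq> 0 \<and> g v = exp (2 * pi * \<i> * \<alpha>) *\<^sub>C v)}"

definition V_br :: "('v::cvector \<Rightarrow> 'v) \<Rightarrow> complex \<Rightarrow> 'v set" where
  "V_br g \<alpha> = (if \<alpha> \<in> P_set g then gen_eigenspace g (exp (2 * pi * \<i> * \<alpha>)) else {0})"

definition semisimple_part :: "('v::cvector \<Rightarrow> 'v) \<Rightarrow> 'v \<Rightarrow> 'v" where
  "semisimple_part g v =
     (\<Sum>\<alpha> | component (V_br g) \<alpha> v \<noteq> 0. \<alpha> *\<^sub>C component (V_br g) \<alpha> v)"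

definition exp_nilpotent :: "('v::cvector \<Rightarrow> 'v) \<Rightarrow> complex \<Rightarrow> 'v \<Rightarrow> 'v" where
  "exp_nilpotent N t v = (\<Sum>p | (N ^^ p) v \<noteq> 0. (t ^ p / fact p) *\<^sub>C (N ^^ p) v)"

text \<open>The operator \<open>\<N>\<^sub>g\<close>: \<open>g = exp (2\<pi>\<i> (\<S>\<^sub>g + \<N>\<^sub>g))\<close>, and on each \<open>V\<^sup>[\<^sup>\<alpha>\<^sup>]\<close> the semisimple part acts as \<open>\<alpha>\<close>.\<close>

definition nilpotent_part :: "('v::cvector \<Rightarrow> 'v) \<Rightarrow> 'v \<Rightarrow> 'v" where
  "nilpotent_part g = (THE N. clinear N \<and> (\<forall>v. \<exists>K. (N ^^ K) v = 0) \<and>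
     (\<forall>v. N (semisimple_part g v) = semisimple_part g (N v)) \<and>
     (\<forall>\<alpha>. \<forall>v\<in>V_br g \<alpha>. g v = exp (2 * pi * \<i> * \<alpha>) *\<^sub>C exp_nilpotent N (2 * pi * \<i>) v))"

text \<open>\<open>exp_log g t v\<close> is \<open>e\<^bsup>t\<L>\<^sub>g\<^esup> v\<close>.\<close>

definition exp_log :: "('v::cvector \<Rightarrow> 'v) \<Rightarrow> complex \<Rightarrow> 'v \<Rightarrow> 'v" where
  "exp_log g t v = (\<Sum>\<alpha> | component (V_br g) \<alpha> v \<noteq> 0.
     exp (t * \<alpha>) *\<^sub>C exp_nilpotent (nilpotent_part g) t (component (V_br g) \<alpha> v))"

text \<open>
  \<open>twist g i c j k v\<close> is \<open>((i + c j) / k)\<close> to the power \<open>\<L>\<^sub>g\<close>, applied to \<open>v\<close>.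
\<close>

definition twist :: "('v::cvector \<Rightarrow> 'v) \<Rightarrow> var \<Rightarrow> complex \<Rightarrow> var \<Rightarrow> var \<Rightarrow> 'v \<Rightarrow> 'v series" where
  "twist g i c j k v e =
     (\<Sum>\<alpha> | component (V_br g) \<alpha> v \<noteq> 0.
        let u = component (V_br g) \<alpha> v; N = nilpotent_part g in
        \<Sum>p | (N ^^ p) u \<noteq> 0.
          (series_mult (pow_quot_series i c j k \<alpha>) (series_pow (log_quot_series i c j k) p) e / fact p)
            *\<^sub>C (N ^^ p) u)"

section \<open>Twisted modules\<close>

text \<open>
  A module is carried by a subspace of an ambient vector space, and the automorphism by which it is
  twisted is part of the data. \<open>mode W v n k w\<close> is \<open>v\<^bsub>n,k\<^esub> w\<close>.
\<close>

record ('v, 'w) tmod =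
  aut :: "'v \<Rightarrow> 'v"
  space_of :: "'w set"
  wt :: "complex \<Rightarrow> 'w set"
  mode :: "'v \<Rightarrow> complex \<Rightarrow> nat \<Rightarrow> 'w \<Rightarrow> 'w"
  L0 :: "'w \<Rightarrow> 'w"
  Lm1 :: "'w \<Rightarrow> 'w"

text \<open>Elements of the completion are families of weight components.\<close>

definition completion :: "('v, 'w::cvector) tmod \<Rightarrow> (complex \<Rightarrow> 'w) set" where
  "completion W = {\<phi>. \<forall>m. \<phi> m \<in> wt W m}"

text \<open>
  The element of the completion obtained from \<open>\<Sum> s n k x\<^sup>-\<^sup>n\<^sup>-\<^sup>1 (log x)\<^sup>k\<close> by putting \<open>x\<^sup>a = e\<^sup>a\<^sup>l\<close> and
  \<open>log x = l\<close>.
\<close>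

definition subst_log :: "('v, 'w::cvector) tmod \<Rightarrow> complex \<Rightarrow> (complex \<Rightarrow> nat \<Rightarrow> 'w) \<Rightarrow> complex \<Rightarrow> 'w" where
  "subst_log W l s m =
     (\<Sum>(n, k) \<in> {(n, k). component (wt W) m (s n k) \<noteq> 0}.
        (exp ((- n - 1) * l) * l ^ k) *\<^sub>C component (wt W) m (s n k))"

definition log_branch :: "int \<Rightarrow> complex \<Rightarrow> complex" where
  "log_branch p z = of_real (ln (norm z)) + \<i> * of_real (Arg2pi z) + 2 * pi * \<i> * of_int p"

text \<open>
  Equivariance is an identity in the completion, so the axioms of a weak twisted module are
  stated together with the grading by generalized eigenspaces of \<open>L(0)\<close>.
\<close>

definition generalized_twisted_module :: "'v::cvector vertex_data \<Rightarrow> ('v, 'w::cvector) tmod \<Rightarrow> bool" where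
  "generalized_twisted_module V W \<longleftrightarrow>
     aut W \<in> automorphisms V \<and>
     direct_sum (space_of W) (wt W) \<and>
     clinear_on (space_of W) (space_of W) (L0 W) \<and>
     clinear_on (space_of W) (space_of W) (Lm1 W) \<and>
     (\<forall>m. \<forall>w\<in>wt W m. \<exists>K\<ge>1. ((\<lambda>u. L0 W u - m *\<^sub>C u) ^^ K) w = 0) \<and>
     (\<forall>v n k. clinear_on (space_of W) (space_of W) (mode W v n k)) \<and>
     (\<forall>n k. \<forall>w\<in>space_of W. clinear (\<lambda>v. mode W v n k w)) \<and>
     (\<forall>v. \<forall>w\<in>space_of W. \<exists>K. \<forall>n. \<forall>k>K. mode W v n k w = 0) \<and>
     (\<forall>v. \<forall>w\<in>space_of W. \<exists>N. \<forall>n k. Re n > N \<longrightarrow> mode W v n k w = 0) \<and>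
     (\<forall>p z v. \<forall>w\<in>space_of W. z \<noteq> 0 \<longrightarrow>
        subst_log W (log_branch (p + 1) z) (\<lambda>n k. mode W (aut W v) n k w) =
        subst_log W (log_branch p z) (\<lambda>n k. mode W v n k w)) \<and>
     (\<forall>n k. \<forall>w\<in>space_of W. mode W (vacuum V) n k w = (if n = - 1 \<and> k = 0 then w else 0)) \<and>
     (\<forall>u v e. \<forall>w\<in>space_of W.
        series_mult (delta_series X0 1 X1 (- 1) X2)
          (two_var X1 X2 (\<lambda>n k n' k'. mode W u n k (mode W v n' k' w))) e
      - series_mult (delta_series X0 (- 1) X2 (- 1) X1)
          (two_var X2 X1 (\<lambda>n k n' k'. mode W v n k (mode W u n' k' w))) e
      = series_mult (delta_series X1 1 X2 1 X0)
          (series_apply (\<lambda>u'. two_var X0 X2 (\<lambda>n k n' k'. mode W (vcoeff V u' n k v) n' k' w))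
             (twist (aut W) X2 1 X0 X1 u)) e) \<and>
     (\<forall>v n k. \<forall>w\<in>space_of W. L0 W (mode W v n k w) - mode W v n k (L0 W w) =
        x_ddx (\<lambda>n k. mode W v n k w) n k + mode W (VL0 V v) n k w) \<and>
     (\<forall>v n k. \<forall>w\<in>space_of W. ddx (\<lambda>n k. mode W v n k w) n k = mode W (VLm1 V v) n k w) \<and>
     (\<forall>v n k. \<forall>w\<in>space_of W.
        mode W (VLm1 V v) n k w = Lm1 W (mode W v n k w) - mode W v n k (Lm1 W w))"

definition lower_bounded :: "('v, 'w::cvector) tmod \<Rightarrow> bool" where
  "lower_bounded W \<longleftrightarrow> (\<exists>N::int. \<forall>m. Re m < of_int N \<longrightarrow> wt W m = {0})"

definition grading_restricted :: "('v, 'w::cvector) tmod \<Rightarrow> bool" where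
  "grading_restricted W \<longleftrightarrow> lower_bounded W \<and> (\<forall>m. finite_dim (wt W m))"

definition C_sub :: "'v::cvector vertex_data \<Rightarrow> nat \<Rightarrow> ('v, 'w::cvector) tmod \<Rightarrow> 'w set" where
  "C_sub V n W = cvec.span {mode W u (\<alpha> - of_nat n) 0 w | \<alpha> u w.
     \<alpha> \<in> P_set (aut W) \<and> u \<in> V_br (aut W) \<alpha> \<inter> V_plus V \<and> w \<in> space_of W}"

text \<open>Finite dimension of the quotient by \<open>C_sub V n W\<close>: finitely many cosets span it.\<close>

definition C_cofinite :: "'v::cvector vertex_data \<Rightarrow> nat \<Rightarrow> ('v, 'w::cvector) tmod \<Rightarrow> bool" where
  "C_cofinite V n W \<longleftrightarrow>
     (\<exists>F. finite F \<and> F \<subseteq> space_of W \<and> space_of W \<subseteq> cvec.span (C_sub V n W \<union> F))"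

text \<open>Extensionality makes equality of module maps mean equality on the domain.\<close>

definition module_maps :: "('v, 'w::cvector) tmod \<Rightarrow> ('v, 'w) tmod \<Rightarrow> ('w \<Rightarrow> 'w) set" where
  "module_maps W W' = {f. aut W = aut W' \<and> f \<in> extensional (space_of W) \<and>
     clinear_on (space_of W) (space_of W') f \<and>
     (\<forall>v n k. \<forall>w\<in>space_of W. f (mode W v n k w) = mode W' v n k (f w)) \<and>
     (\<forall>w\<in>space_of W. f (L0 W w) = L0 W' (f w)) \<and>
     (\<forall>w\<in>space_of W. f (Lm1 W w) = Lm1 W' (f w))}"

text \<open>Module maps preserve the gradings, so they extend to completions componentwise.\<close>

definition extend_map :: "('w \<Rightarrow> 'w) \<Rightarrow> (complex \<Rightarrow> 'w) \<Rightarrow> complex \<Rightarrow> 'w" where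
  "extend_map f \<phi> = (\<lambda>m. f (\<phi> m))"

section \<open>Categories and functors\<close>

text \<open>The morphism sets are indexed by pairs of objects and need not be disjoint.\<close>

record ('o, 'm) cat =
  Ob :: "'o set"
  Hom :: "'o \<Rightarrow> 'o \<Rightarrow> 'm set"
  Ident :: "'o \<Rightarrow> 'm"
  Compose :: "'o \<Rightarrow> 'o \<Rightarrow> 'o \<Rightarrow> 'm \<Rightarrow> 'm \<Rightarrow> 'm"

definition is_category :: "('o, 'm) cat \<Rightarrow> bool" where
  "is_category C \<longleftrightarrow>
     (\<forall>a\<in>Ob C. Ident C a \<in> Hom C a a) \<and>
     (\<forall>a\<in>Ob C. \<forall>b\<in>Ob C. \<forall>c\<in>Ob C. \<forall>f\<in>Hom C a b. \<forall>g\<in>Hom C b c. Compose C a b c g f \<in> Hom C a c) \<and>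
     (\<forall>a\<in>Ob C. \<forall>b\<in>Ob C. \<forall>f\<in>Hom C a b.
        Compose C a a b f (Ident C a) = f \<and> Compose C a b b (Ident C b) f = f) \<and>
     (\<forall>a\<in>Ob C. \<forall>b\<in>Ob C. \<forall>c\<in>Ob C. \<forall>d\<in>Ob C. \<forall>f\<in>Hom C a b. \<forall>g\<in>Hom C b c. \<forall>h\<in>Hom C c d.
        Compose C a c d h (Compose C a b c g f) = Compose C a b d (Compose C b c d h g) f)"

definition product_cat :: "('o, 'm) cat \<Rightarrow> ('p, 'n) cat \<Rightarrow> ('o \<times> 'p, 'm \<times> 'n) cat" where
  "product_cat C D = \<lparr>Ob = Ob C \<times> Ob D,
     Hom = (\<lambda>(a, a') (b, b'). Hom C a b \<times> Hom D a' b'),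
     Ident = (\<lambda>(a, a'). (Ident C a, Ident D a')),
     Compose = (\<lambda>(a, a') (b, b') (c, c') (g, g') (f, f').
       (Compose C a b c g f, Compose D a' b' c' g' f'))\<rparr>"

definition is_functor ::
  "('o, 'm) cat \<Rightarrow> ('p, 'n) cat \<Rightarrow> ('o \<Rightarrow> 'p) \<Rightarrow> ('o \<Rightarrow> 'o \<Rightarrow> 'm \<Rightarrow> 'n) \<Rightarrow> bool" where
  "is_functor C D Fo Fm \<longleftrightarrow> is_category C \<and> is_category D \<and>
     (\<forall>a\<in>Ob C. Fo a \<in> Ob D) \<and>
     (\<forall>a\<in>Ob C. \<forall>b\<in>Ob C. \<forall>f\<in>Hom C a b. Fm a b f \<in> Hom D (Fo a) (Fo b)) \<and>
     (\<forall>a\<in>Ob C. Fm a a (Ident C a) = Ident D (Fo a)) \<and>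
     (\<forall>a\<in>Ob C. \<forall>b\<in>Ob C. \<forall>c\<in>Ob C. \<forall>f\<in>Hom C a b. \<forall>g\<in>Hom C b c.
        Fm a c (Compose C a b c g f) = Compose D (Fo a) (Fo b) (Fo c) (Fm b c g) (Fm a b f))"

text \<open>The category \<open>\<C>\<^sub>n\<^sup>G\<close>, with modules carried by subspaces of \<open>'w\<close>.\<close>

definition cofinite_cat :: "'v::cvector vertex_data \<Rightarrow> ('v \<Rightarrow> 'v) set \<Rightarrow> nat \<Rightarrow>
    (('v, 'w::cvector) tmod, 'w \<Rightarrow> 'w) cat" where
  "cofinite_cat V G n = \<lparr>
     Ob = {W. aut W \<in> G \<and> generalized_twisted_module V W \<and> grading_restricted W \<and> C_cofinite V n W},
     Hom = module_maps,
     Ident = (\<lambda>W. restrict id (space_of W)),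
     Compose = (\<lambda>W W' W'' g f. compose (space_of W) g f)\<rparr>"

section \<open>Twisted intertwining operators and \<open>P(z)\<close>-tensor products\<close>

text \<open>\<open>I w\<^sub>1 n k w\<^sub>2\<close> is the coefficient of \<open>x\<^sup>-\<^sup>n\<^sup>-\<^sup>1 (log x)\<^sup>k\<close> in the intertwining operator.\<close>

definition twisted_intertwining_operator :: "'v::cvector vertex_data \<Rightarrow> ('v, 'w::cvector) tmod \<Rightarrow>
    ('v, 'w) tmod \<Rightarrow> ('v, 'w) tmod \<Rightarrow> ('w \<Rightarrow> complex \<Rightarrow> nat \<Rightarrow> 'w \<Rightarrow> 'w) \<Rightarrow> bool" where
  "twisted_intertwining_operator V W1 W2 W3 I \<longleftrightarrow>
     generalized_twisted_module V W1 \<and> generalized_twisted_module V W2 \<and>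
     generalized_twisted_module V W3 \<and>
     aut W1 \<circ> aut W2 = aut W2 \<circ> aut W1 \<and> aut W3 = aut W1 \<circ> aut W2 \<and>
     (\<forall>w1\<in>space_of W1. \<forall>n k. clinear_on (space_of W2) (space_of W3) (I w1 n k)) \<and>
     (\<forall>w2\<in>space_of W2. \<forall>n k. clinear_on (space_of W1) (space_of W3) (\<lambda>w1. I w1 n k w2)) \<and>
     (\<forall>w1\<in>space_of W1. \<forall>w2\<in>space_of W2. \<exists>K. \<forall>n. \<forall>k>K. I w1 n k w2 = 0) \<and>
     (\<forall>w1\<in>space_of W1. \<forall>w2\<in>space_of W2. \<exists>N. \<forall>n k. Re n > N \<longrightarrow> I w1 n k w2 = 0) \<and>
     (\<forall>v e. \<forall>w1\<in>space_of W1. \<forall>w2\<in>space_of W2.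
        series_mult (delta_series X0 1 X1 (- 1) X2)
          (series_apply (\<lambda>u. two_var X1 X2 (\<lambda>n k n' k'. mode W3 u n k (I w1 n' k' w2)))
             (twist (aut W1) X1 (- 1) X2 X0 v)) e
      - series_mult (delta_series X0 (- 1) X2 (- 1) X1)
          (series_apply (\<lambda>u. two_var X2 X1 (\<lambda>n k n' k'. I w1 n k (mode W2 u n' k' w2)))
             (\<lambda>d. exp_log (aut W1) (pi * \<i>) (twist (aut W1) X2 (- 1) X1 X0 v d))) e
      = series_mult (delta_series X1 1 X2 1 X0)
          (series_apply (\<lambda>u. two_var X0 X2 (\<lambda>n k n' k'. I (mode W1 u n k w1) n' k' w2))
             (twist (aut W2) X2 1 X0 X1 v)) e) \<and>
     (\<forall>n k. \<forall>w1\<in>space_of W1. \<forall>w2\<in>space_of W2. L0 W3 (I w1 n k w2) - I w1 n k (L0 W2 w2) =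
        x_ddx (\<lambda>n k. I w1 n k w2) n k + I (L0 W1 w1) n k w2) \<and>
     (\<forall>n k. \<forall>w1\<in>space_of W1. \<forall>w2\<in>space_of W2.
        ddx (\<lambda>n k. I w1 n k w2) n k = I (Lm1 W1 w1) n k w2) \<and>
     (\<forall>n k. \<forall>w1\<in>space_of W1. \<forall>w2\<in>space_of W2.
        I (Lm1 W1 w1) n k w2 = Lm1 W3 (I w1 n k w2) - I w1 n k (Lm1 W2 w2))"

text \<open>
  Linear maps from the tensor product of \<open>W\<^sub>1\<close> and \<open>W\<^sub>2\<close> to the completion of \<open>W\<^sub>3\<close>
  are written as bilinear maps.
\<close>

definition Pz_intertwining_map :: "'v::cvector vertex_data \<Rightarrow> complex \<Rightarrow> ('v, 'w::cvector) tmod \<Rightarrow>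
    ('v, 'w) tmod \<Rightarrow> ('v, 'w) tmod \<Rightarrow> ('w \<Rightarrow> 'w \<Rightarrow> complex \<Rightarrow> 'w) \<Rightarrow> bool" where
  "Pz_intertwining_map V z W1 W2 W3 J \<longleftrightarrow>
     (\<forall>w1\<in>space_of W1. \<forall>w2\<in>space_of W2. J w1 w2 \<in> completion W3) \<and>
     (\<forall>w1\<in>space_of W1. \<forall>m. clinear_on (space_of W2) (space_of W3) (\<lambda>w2. J w1 w2 m)) \<and>
     (\<forall>w2\<in>space_of W2. \<forall>m. clinear_on (space_of W1) (space_of W3) (\<lambda>w1. J w1 w2 m)) \<and>
     (\<exists>I. twisted_intertwining_operator V W1 W2 W3 I \<and>
        (\<forall>w1\<in>space_of W1. \<forall>w2\<in>space_of W2.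
           J w1 w2 = subst_log W3 (log_branch 0 z) (\<lambda>n k. I w1 n k w2)))"

definition Pz_product :: "'v::cvector vertex_data \<Rightarrow> ('v \<Rightarrow> 'v) set \<Rightarrow> nat \<Rightarrow> complex \<Rightarrow>
    ('v, 'w::cvector) tmod \<Rightarrow> ('v, 'w) tmod \<Rightarrow> ('v, 'w) tmod \<Rightarrow> ('w \<Rightarrow> 'w \<Rightarrow> complex \<Rightarrow> 'w) \<Rightarrow> bool" where
  "Pz_product V G n z W1 W2 W3 J \<longleftrightarrow> W3 \<in> Ob (cofinite_cat V G n) \<and>
     aut W3 = aut W1 \<circ> aut W2 \<and> Pz_intertwining_map V z W1 W2 W3 J"

definition Pz_tensor_product :: "'v::cvector vertex_data \<Rightarrow> ('v \<Rightarrow> 'v) set \<Rightarrow> nat \<Rightarrow> complex \<Rightarrow>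
    ('v, 'w::cvector) tmod \<Rightarrow> ('v, 'w) tmod \<Rightarrow> ('v, 'w) tmod \<Rightarrow> ('w \<Rightarrow> 'w \<Rightarrow> complex \<Rightarrow> 'w) \<Rightarrow> bool" where
  "Pz_tensor_product V G n z W1 W2 W0 J0 \<longleftrightarrow> Pz_product V G n z W1 W2 W0 J0 \<and>
     (\<forall>W3 J. Pz_product V G n z W1 W2 W3 J \<longrightarrow>
        (\<exists>!f. f \<in> module_maps W0 W3 \<and>
           (\<forall>w1\<in>space_of W1. \<forall>w2\<in>space_of W2. extend_map f (J0 w1 w2) = J w1 w2)))"

text \<open>
  Here \<open>(T W\<^sub>1 W\<^sub>2, B W\<^sub>1 W\<^sub>2)\<close> is any choice of \<open>P(z)\<close>-tensor products, for instance
  the graded dual of the span of the functionals \<open>\<langle>w\<^sub>3', J w\<^sub>1 w\<^sub>2\<rangle>\<close> over all \<open>P(z)\<close>-products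
  \<open>(W\<^sub>3, J)\<close>, identified with a subspace of \<open>'w\<close>. The property \<open>is_tensor_map\<close> characterizes the
  morphism induced by \<open>f\<^sub>1\<close> and \<open>f\<^sub>2\<close>.
\<close>

definition is_tensor_map ::
  "(('v, 'w::cvector) tmod \<Rightarrow> ('v, 'w) tmod \<Rightarrow> ('v, 'w) tmod) \<Rightarrow>
   (('v, 'w) tmod \<Rightarrow> ('v, 'w) tmod \<Rightarrow> 'w \<Rightarrow> 'w \<Rightarrow> complex \<Rightarrow> 'w) \<Rightarrow>
   ('v, 'w) tmod \<times> ('v, 'w) tmod \<Rightarrow> ('v, 'w) tmod \<times> ('v, 'w) tmod \<Rightarrow>
   ('w \<Rightarrow> 'w) \<times> ('w \<Rightarrow> 'w) \<Rightarrow> ('w \<Rightarrow> 'w) \<Rightarrow> bool" where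
  "is_tensor_map T B = (\<lambda>(W1, W2) (W1', W2') (f1, f2) f.
     f \<in> module_maps (T W1 W2) (T W1' W2') \<and>
     (\<forall>w1\<in>space_of W1. \<forall>w2\<in>space_of W2.
        extend_map f (B W1 W2 w1 w2) = B W1' W2' (f1 w1) (f2 w2)))"

definition tensor_map ::
  "(('v, 'w::cvector) tmod \<Rightarrow> ('v, 'w) tmod \<Rightarrow> ('v, 'w) tmod) \<Rightarrow>
   (('v, 'w) tmod \<Rightarrow> ('v, 'w) tmod \<Rightarrow> 'w \<Rightarrow> 'w \<Rightarrow> complex \<Rightarrow> 'w) \<Rightarrow>
   ('v, 'w) tmod \<times> ('v, 'w) tmod \<Rightarrow> ('v, 'w) tmod \<times> ('v, 'w) tmod \<Rightarrow>
   ('w \<Rightarrow> 'w) \<times> ('w \<Rightarrow> 'w) \<Rightarrow> 'w \<Rightarrow> 'w" where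
  "tensor_map T B P P' f = (THE h. is_tensor_map T B P P' f h)"

end

theory Submission
  imports Defs
begin

text \<open>
  Composing a twisted intertwining operator with module maps into its two sources gives again a
  twisted intertwining operator, because every axiom involves the source modules only through
  operations that module maps commute with. So \<open>(w\<^sub>1, w\<^sub>2) \<mapsto> f\<^sub>1 w\<^sub>1 \<boxtimes> f\<^sub>2 w\<^sub>2\<close> is a \<open>P(z)\<close>-product of
  the sources, and the universal property yields the unique morphism \<open>f\<^sub>1 \<boxtimes> f\<^sub>2\<close>. Uniqueness forces
  compatibility with identities and compositions.
\<close>

lemma clinear_on_compose:
  assumes "clinear_on S T f" "clinear_on T U g"
  shows "clinear_on S U (\<lambda>x. g (f x))"
  using assms unfolding clinear_on_def by simp

text \<open>Module maps are extensional, so \<open>restrict\<close> and \<open>compose\<close> agree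
  with the plain functions only on the carrier. Being a subspace keeps \<open>x + y\<close> and
  \<open>c *\<^sub>C x\<close> where the two functions agree.\<close>

lemma clinear_on_cong:
  assumes "clinear_on S T f" "cvec.subspace S" "\<And>x. x \<in> S \<Longrightarrow> g x = f x"
  shows "clinear_on S T g"
  using assms unfolding clinear_on_def
  by (simp add: cvec.subspace_add cvec.subspace_scale)

lemma module_mapsD:
  assumes "f \<in> module_maps W W'"
  shows "aut W = aut W'" "f \<in> extensional (space_of W)" "clinear_on (space_of W) (space_of W') f"
    and "w \<in> space_of W \<Longrightarrow> f w \<in> space_of W'"
    and "w \<in> space_of W \<Longrightarrow> f (mode W v n k w) = mode W' v n k (f w)"
    and "w \<in> space_of W \<Longrightarrow> f (L0 W w) = L0 W' (f w)"
    and "w \<in> space_of W \<Longrightarrow> f (Lm1 W w) = Lm1 W' (f w)"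
  using assms unfolding module_maps_def clinear_on_def by blast+

lemma generalized_twisted_moduleD:
  assumes "generalized_twisted_module V W"
  shows "cvec.subspace (space_of W)" "wt W m \<subseteq> space_of W"
    and "w \<in> space_of W \<Longrightarrow> mode W v n k w \<in> space_of W"
    and "w \<in> space_of W \<Longrightarrow> L0 W w \<in> space_of W"
    and "w \<in> space_of W \<Longrightarrow> Lm1 W w \<in> space_of W"
proof -
  have "direct_sum (space_of W) (wt W)" "clinear_on (space_of W) (space_of W) (mode W v n k)"
    "clinear_on (space_of W) (space_of W) (L0 W)" "clinear_on (space_of W) (space_of W) (Lm1 W)"
    using assms by (simp_all add: generalized_twisted_module_def)
  then show "cvec.subspace (space_of W)" "wt W m \<subseteq> space_of W"
    "w \<in> space_of W \<Longrightarrow> mode W v n k w \<in> space_of W"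
    "w \<in> space_of W \<Longrightarrow> L0 W w \<in> space_of W"
    "w \<in> space_of W \<Longrightarrow> Lm1 W w \<in> space_of W"
    by (simp_all add: direct_sum_def clinear_on_def)
qed

lemma module_maps_id:
  assumes "generalized_twisted_module V W"
  shows "restrict id (space_of W) \<in> module_maps W W"
proof -
  note W = generalized_twisted_moduleD[OF assms]
  have "clinear_on (space_of W) (space_of W) (restrict id (space_of W))"
    by (rule clinear_on_cong[of _ _ id]) (simp_all add: W clinear_on_def)
  then show ?thesis
    by (simp add: module_maps_def W)
qed

lemma module_maps_compose:
  assumes "generalized_twisted_module V W" "f \<in> module_maps W W'" "g \<in> module_maps W' W''"
  shows "compose (space_of W) g f \<in> module_maps W W''"
proof -
  note W = generalized_twisted_moduleD[OF assms(1)]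
  note f = module_mapsD[OF assms(2)] and g = module_mapsD[OF assms(3)]
  have "clinear_on (space_of W) (space_of W'') (compose (space_of W) g f)"
    by (rule clinear_on_cong[OF clinear_on_compose[OF f(3) g(3)] W(1)]) (simp add: compose_eq)
  then show ?thesis
    by (simp add: module_maps_def compose_eq W f g)
qed

text \<open>The laws are equations between total functions. Off the carrier of the source both sides
  are \<open>undefined\<close>, and on it they reduce to evaluation.\<close>

lemma is_category_cofinite_cat: "is_category (cofinite_cat V G n)"
  unfolding is_category_def cofinite_cat_def
proof (simp, intro conjI allI ballI impI, goal_cases)
  case (1 W)
  then show ?case
    using module_maps_id by blast
next
  case (2 W W' W'' f g)
  then show ?case
    using module_maps_compose by blast
next
  case (3 W W' f)
  then have "f \<in> extensional (space_of W)"
    by (simp add: module_mapsD)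
  then show ?case
    by (auto simp: compose_def fun_eq_iff extensional_def)
next
  case (4 W W' f)
  then have "f \<in> extensional (space_of W)" "w \<in> space_of W \<Longrightarrow> f w \<in> space_of W'" for w
    using module_mapsD by blast+
  then show ?case
    by (auto simp: compose_def fun_eq_iff extensional_def)
next
  case (5 W W' W2 W3 f g h)
  \<comment> \<open>One bracketing restricts \<open>h\<close> after \<open>g\<close> to the carrier
    of \<open>W'\<close>, so the values of \<open>f\<close> have to lie there.\<close>
  then have "w \<in> space_of W \<Longrightarrow> f w \<in> space_of W'" for w
    using module_mapsD by blast
  then show ?case
    by (auto simp: compose_def fun_eq_iff)
qed

lemma is_category_product_cat:
  assumes "is_category C" "is_category D"
  shows "is_category (product_cat C D)"
  using assms unfolding is_category_def product_cat_def by (simp add: split_beta)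

text \<open>The twists in the Jacobi identity depend only on the automorphisms of the sources, which
  are equal whenever a module map exists. Each axiom at \<open>w1\<close>, \<open>w2\<close> then
  becomes the axiom for \<open>I\<close> at \<open>f1 w1\<close>, \<open>f2 w2\<close>, by moving
  \<open>f1\<close> and \<open>f2\<close> past the modes, \<open>L0\<close> and
  \<open>Lm1\<close>.\<close>

lemma twisted_intertwining_operator_compose:
  assumes "twisted_intertwining_operator V W1' W2' W3 I"
    and W1: "generalized_twisted_module V W1" and W2: "generalized_twisted_module V W2"
    and f1: "f1 \<in> module_maps W1 W1'" and f2: "f2 \<in> module_maps W2 W2'"
  shows "twisted_intertwining_operator V W1 W2 W3 (\<lambda>w1 n k w2. I (f1 w1) n k (f2 w2))"
proof -
  note f1 = module_mapsD[OF f1] and f2 = module_mapsD[OF f2]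
  \<comment> \<open>Linearity speaks of whole carriers, so it does not follow by instantiating at
    images and is obtained by composing linear maps.\<close>
  have lin1: "clinear_on (space_of W2) (space_of W3) (\<lambda>w2. I (f1 w1) n k (f2 w2))"
    if "w1 \<in> space_of W1" for w1 n k
  proof -
    have "clinear_on (space_of W2') (space_of W3) (I (f1 w1) n k)"
      using assms(1) f1(4)[OF that] unfolding twisted_intertwining_operator_def by simp
    from clinear_on_compose[OF f2(3) this] show ?thesis .
  qed
  have lin2: "clinear_on (space_of W1) (space_of W3) (\<lambda>w1. I (f1 w1) n k (f2 w2))"
    if "w2 \<in> space_of W2" for w2 n k
  proof -
    have "clinear_on (space_of W1') (space_of W3) (\<lambda>w1. I w1 n k (f2 w2))"
      using assms(1) f2(4)[OF that] unfolding twisted_intertwining_operator_def by simp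
    from clinear_on_compose[OF f1(3) this] show ?thesis .
  qed
  show ?thesis
    using assms(1) unfolding twisted_intertwining_operator_def
    by (simp add: lin1 lin2 W1 W2 f1 f2)
qed

text \<open>The target \<open>W3\<close> is unchanged and so remains in the category; only the
  intertwining map has to be replaced. Substituting \<open>z\<close> commutes with precomposition
  because it acts on the coefficients in \<open>W3\<close>.\<close>

lemma Pz_product_compose:
  assumes "Pz_product V G n z W1' W2' W3 J"
    and W1: "generalized_twisted_module V W1" and W2: "generalized_twisted_module V W2"
    and f1: "f1 \<in> module_maps W1 W1'" and f2: "f2 \<in> module_maps W2 W2'"
  shows "Pz_product V G n z W1 W2 W3 (\<lambda>w1 w2. J (f1 w1) (f2 w2))"
proof -
  note f1' = module_mapsD[OF f1] and f2' = module_mapsD[OF f2]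
  have J: "Pz_intertwining_map V z W1' W2' W3 J"
    using assms(1) by (simp add: Pz_product_def)
  then obtain I where I: "twisted_intertwining_operator V W1' W2' W3 I"
    and JI: "\<And>w1 w2. w1 \<in> space_of W1' \<Longrightarrow> w2 \<in> space_of W2' \<Longrightarrow>
      J w1 w2 = subst_log W3 (log_branch 0 z) (\<lambda>n k. I w1 n k w2)"
    unfolding Pz_intertwining_map_def by blast
  have lin1: "clinear_on (space_of W2) (space_of W3) (\<lambda>w2. J (f1 w1) (f2 w2) m)"
    if "w1 \<in> space_of W1" for w1 m
  proof -
    have "clinear_on (space_of W2') (space_of W3) (\<lambda>w2. J (f1 w1) w2 m)"
      using that J f1'(4) unfolding Pz_intertwining_map_def by blast
    from clinear_on_compose[OF f2'(3) this] show ?thesis .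
  qed
  have lin2: "clinear_on (space_of W1) (space_of W3) (\<lambda>w1. J (f1 w1) (f2 w2) m)"
    if "w2 \<in> space_of W2" for w2 m
  proof -
    have "clinear_on (space_of W1') (space_of W3) (\<lambda>w1. J w1 (f2 w2) m)"
      using that J f2'(4) unfolding Pz_intertwining_map_def by blast
    from clinear_on_compose[OF f1'(3) this] show ?thesis .
  qed
  have "Pz_intertwining_map V z W1 W2 W3 (\<lambda>w1 w2. J (f1 w1) (f2 w2))"
    unfolding Pz_intertwining_map_def
  proof (intro conjI ballI allI exI)
    \<comment> \<open>This fixes the operator that the definition of an intertwining map asks
      for.\<close>
    show "twisted_intertwining_operator V W1 W2 W3 (\<lambda>w1 n k w2. I (f1 w1) n k (f2 w2))"
      by (rule twisted_intertwining_operator_compose[OF I W1 W2 f1 f2])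
    show "J (f1 w1) (f2 w2) \<in> completion W3"
      if "w1 \<in> space_of W1" "w2 \<in> space_of W2" for w1 w2
      using that J f1'(4) f2'(4) unfolding Pz_intertwining_map_def by blast
  qed (simp_all add: lin1 lin2 JI f1' f2')
  then show ?thesis
    using assms(1) f1'(1) f2'(1) by (simp add: Pz_product_def)
qed

text \<open>The target's tensor product, with its map precomposed by \<open>f1\<close> and
  \<open>f2\<close>, is a \<open>P(z)\<close>-product of \<open>W1\<close> and \<open>W2\<close>.
  The universal property of \<open>T W1 W2\<close> applied to it is exactly the claim.\<close>

lemma is_tensor_map_ex1:
  assumes "Pz_tensor_product V G n z W1 W2 (T W1 W2) (B W1 W2)"
    and "Pz_tensor_product V G n z W1' W2' (T W1' W2') (B W1' W2')"
    and "generalized_twisted_module V W1" "generalized_twisted_module V W2"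
    and "f1 \<in> module_maps W1 W1'" "f2 \<in> module_maps W2 W2'"
  shows "\<exists>!h. is_tensor_map T B (W1, W2) (W1', W2') (f1, f2) h"
proof -
  have "Pz_product V G n z W1 W2 (T W1' W2') (\<lambda>w1 w2. B W1' W2' (f1 w1) (f2 w2))"
    using Pz_product_compose[OF _ assms(3-6)] assms(2) unfolding Pz_tensor_product_def by blast
  then show ?thesis
    using assms(1) unfolding Pz_tensor_product_def is_tensor_map_def by simp
qed

text \<open>Components lie in weight spaces, hence in the carrier. This lets
  \<open>extend_map\<close> of a \<open>restrict\<close> or a \<open>compose\<close> be evaluated on
  them.\<close>

lemma Pz_product_component_in_space:
  assumes "Pz_product V G n z W1 W2 W3 J" "w1 \<in> space_of W1" "w2 \<in> space_of W2"
  shows "J w1 w2 m \<in> space_of W3"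
proof -
  have "generalized_twisted_module V W3" "J w1 w2 \<in> completion W3"
    using assms by (auto simp: Pz_product_def cofinite_cat_def Pz_intertwining_map_def)
  then show ?thesis
    using generalized_twisted_moduleD(2) by (fastforce simp: completion_def)
qed

lemma is_tensor_map_id:
  assumes "Pz_product V G n z W1 W2 (T W1 W2) (B W1 W2)"
  shows "is_tensor_map T B (W1, W2) (W1, W2) (restrict id (space_of W1), restrict id (space_of W2))
    (restrict id (space_of (T W1 W2)))"
proof -
  have "generalized_twisted_module V (T W1 W2)"
    using assms by (simp add: Pz_product_def cofinite_cat_def)
  then show ?thesis
    using Pz_product_component_in_space[OF assms]
    by (simp add: is_tensor_map_def extend_map_def module_maps_id fun_eq_iff)
qed

text \<open>On each component, \<open>h\<close> turns the product of \<open>w1\<close> and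
  \<open>w2\<close> into that of \<open>f1 w1\<close> and \<open>f2 w2\<close>. These lie in
  \<open>W1'\<close> and \<open>W2'\<close>, so the defining equation of \<open>k\<close> applies
  next.\<close>

lemma is_tensor_map_compose:
  assumes "Pz_product V G n z W1 W2 (T W1 W2) (B W1 W2)"
    and "f1 \<in> module_maps W1 W1'" "f2 \<in> module_maps W2 W2'"
    and "is_tensor_map T B (W1, W2) (W1', W2') (f1, f2) h"
    and "is_tensor_map T B (W1', W2') (W1'', W2'') (g1, g2) k"
  shows "is_tensor_map T B (W1, W2) (W1'', W2'')
    (compose (space_of W1) g1 f1, compose (space_of W2) g2 f2) (compose (space_of (T W1 W2)) k h)"
proof -
  have "compose (space_of (T W1 W2)) k h \<in> module_maps (T W1 W2) (T W1'' W2'')"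
    using assms(1,4,5) module_maps_compose
    by (fastforce simp: Pz_product_def cofinite_cat_def is_tensor_map_def)
  then show ?thesis
    using assms(4,5) Pz_product_component_in_space[OF assms(1)] module_mapsD(4)[OF assms(2)]
      module_mapsD(4)[OF assms(3)]
    by (simp add: is_tensor_map_def extend_map_def compose_eq fun_eq_iff)
qed

theorem theorem5p7:
  fixes V :: "'v::cvector vertex_data"
    and G :: "('v \<Rightarrow> 'v) set"
    and n :: nat
    and z :: complex
    and C :: "(('v, 'w::cvector) tmod, 'w \<Rightarrow> 'w) cat"
    and T :: "('v, 'w) tmod \<Rightarrow> ('v, 'w) tmod \<Rightarrow> ('v, 'w) tmod"
    and B :: "('v, 'w) tmod \<Rightarrow> ('v, 'w) tmod \<Rightarrow> 'w \<Rightarrow> 'w \<Rightarrow> complex \<Rightarrow> 'w"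
  defines "C \<equiv> cofinite_cat V G n"
  assumes "moebius_vertex_algebra V"
    and "abelian_automorphism_group V G"
    and "n \<ge> 2"
    and "z \<noteq> 0"
    and "\<And>W1 W2. W1 \<in> Ob C \<Longrightarrow> W2 \<in> Ob C \<Longrightarrow>
           Pz_tensor_product V G n z W1 W2 (T W1 W2) (B W1 W2)"
  shows "(\<forall>P \<in> Ob (product_cat C C). \<forall>P' \<in> Ob (product_cat C C). \<forall>f \<in> Hom (product_cat C C) P P'.
            \<exists>!h. is_tensor_map T B P P' f h) \<and>
         is_functor (product_cat C C) C (\<lambda>(W1, W2). T W1 W2) (tensor_map T B)"
proof -
  have cat: "is_category C" "is_category (product_cat C C)"
    by (simp_all add: C_def is_category_cofinite_cat is_category_product_cat)
  have mod: "generalized_twisted_module V W" if "W \<in> Ob C" for W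
    using that by (simp add: C_def cofinite_cat_def)
  have C_simps: "Hom C = module_maps" "Ident C = (\<lambda>W. restrict id (space_of W))"
    "Compose C = (\<lambda>W W' W'' g f. compose (space_of W) g f)"
    by (simp_all add: C_def cofinite_cat_def)
  have prod: "Pz_product V G n z W1 W2 (T W1 W2) (B W1 W2)" if "W1 \<in> Ob C" "W2 \<in> Ob C" for W1 W2
    using assms(6)[OF that] by (simp add: Pz_tensor_product_def)
  have ob: "T W1 W2 \<in> Ob C" if "W1 \<in> Ob C" "W2 \<in> Ob C" for W1 W2
    using prod[OF that] by (simp add: Pz_product_def C_def)
  have ex1: "\<exists>!h. is_tensor_map T B (W1, W2) (W1', W2') (f1, f2) h"
    if "W1 \<in> Ob C" "W2 \<in> Ob C" "W1' \<in> Ob C" "W2' \<in> Ob C"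
      "f1 \<in> module_maps W1 W1'" "f2 \<in> module_maps W2 W2'" for W1 W2 W1' W2' f1 f2
    by (rule is_tensor_map_ex1[OF assms(6) assms(6) mod mod]) (rule that)+
  \<comment> \<open>Unique existence gives the definite description \<open>tensor_map\<close> its
    meaning: it has the defining property, and any map with that property equals it.\<close>
  have tensor_map: "is_tensor_map T B (W1, W2) (W1', W2') (f1, f2)
      (tensor_map T B (W1, W2) (W1', W2') (f1, f2))"
    if "W1 \<in> Ob C" "W2 \<in> Ob C" "W1' \<in> Ob C" "W2' \<in> Ob C"
      "f1 \<in> module_maps W1 W1'" "f2 \<in> module_maps W2 W2'" for W1 W2 W1' W2' f1 f2
    unfolding tensor_map_def by (rule theI'[OF ex1[OF that]])
  have tensor_map_eq: "tensor_map T B (W1, W2) (W1', W2') (f1, f2) = h"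
    if "is_tensor_map T B (W1, W2) (W1', W2') (f1, f2) h"
      "W1 \<in> Ob C" "W2 \<in> Ob C" "W1' \<in> Ob C" "W2' \<in> Ob C"
      "f1 \<in> module_maps W1 W1'" "f2 \<in> module_maps W2 W2'" for W1 W2 W1' W2' f1 f2 h
    unfolding tensor_map_def by (rule the1_equality[OF ex1]) (rule that)+
  have hom: "tensor_map T B (W1, W2) (W1', W2') (f1, f2) \<in> module_maps (T W1 W2) (T W1' W2')"
    if "W1 \<in> Ob C" "W2 \<in> Ob C" "W1' \<in> Ob C" "W2' \<in> Ob C"
      "f1 \<in> module_maps W1 W1'" "f2 \<in> module_maps W2 W2'" for W1 W2 W1' W2' f1 f2
    using tensor_map[OF that] by (simp add: is_tensor_map_def)
  have ident: "tensor_map T B (W1, W2) (W1, W2) (restrict id (space_of W1), restrict id (space_of W2))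
      = restrict id (space_of (T W1 W2))"
    if "W1 \<in> Ob C" "W2 \<in> Ob C" for W1 W2
    by (rule tensor_map_eq[OF is_tensor_map_id[where T = T and B = B, OF prod]])
      (simp_all add: that module_maps_id[OF mod])
  have comp: "tensor_map T B (W1, W2) (W1'', W2'')
        (compose (space_of W1) g1 f1, compose (space_of W2) g2 f2)
      = compose (space_of (T W1 W2)) (tensor_map T B (W1', W2') (W1'', W2'') (g1, g2))
          (tensor_map T B (W1, W2) (W1', W2') (f1, f2))"
    if "W1 \<in> Ob C" "W2 \<in> Ob C" "W1' \<in> Ob C" "W2' \<in> Ob C" "W1'' \<in> Ob C" "W2'' \<in> Ob C"
      and f: "f1 \<in> module_maps W1 W1'" "f2 \<in> module_maps W2 W2'"
      and g: "g1 \<in> module_maps W1' W1''" "g2 \<in> module_maps W2' W2''"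
    for W1 W2 W1' W2' W1'' W2'' f1 f2 g1 g2
  \<comment> \<open>By uniqueness it suffices that the composite of the two induced morphisms has
    the property defining the morphism induced by the composites.\<close>
  proof (rule tensor_map_eq)
    show "is_tensor_map T B (W1, W2) (W1'', W2'')
        (compose (space_of W1) g1 f1, compose (space_of W2) g2 f2)
        (compose (space_of (T W1 W2)) (tensor_map T B (W1', W2') (W1'', W2'') (g1, g2))
          (tensor_map T B (W1, W2) (W1', W2') (f1, f2)))"
      by (rule is_tensor_map_compose[OF prod _ _ tensor_map tensor_map]) (rule that)+
    show "compose (space_of W1) g1 f1 \<in> module_maps W1 W1''"
      "compose (space_of W2) g2 f2 \<in> module_maps W2 W2''"
      using module_maps_compose mod that by blast+
  qed (use that in auto)
  have "is_functor (product_cat C C) C (\<lambda>(W1, W2). T W1 W2) (tensor_map T B)"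
    unfolding is_functor_def
    \<comment> \<open>Once objects and morphisms of the product category are split into pairs, the
      functor axioms are \<open>ob\<close>, \<open>hom\<close>, \<open>ident\<close> and
      \<open>comp\<close>.\<close>
    by (intro conjI cat) (auto simp: product_cat_def C_simps intro: ob hom ident comp)
  then show ?thesis
    by (simp add: product_cat_def C_simps ex1)
qed

end
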